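(* Let $n\ge1$. The map sending a torsion class $\mathcal G$ of size $n$ to its Young diagram with gaps $Y(\mathcal G)$, and then to the Young diagram obtained from $Y(\mathcal G)$ by removing the gaps, is a bijection from the set of torsion classes of size $n$ onto the set of Young diagrams that are subdiagrams of the full Young diagram $(n,n-1,\dots,2,1)$ of size $n$.
   Context: Torsion classes of size $n$. The objects are $\tfrac{n(n+1)}2$ balls arranged in a triangle with $1$ ball in the top row, $2$ in the second row, ..., $n$ in the bottom row. Index the balls by pairs $[i,j]$ with $1\le i\le j\le n$, with $[i,j]$ drawn at the point $\left(\tfrac{i+j}2,\tfrac{j-i}2\right)$. (They represent the indecomposable representations of the linearly oriented quiver $A_n$.) $\mathrm{Hom}(X,Y)\neq0$ iff the entire rectangle with left corner $X$ and right corner $Y$ lies in the triangle; explicitly, $\mathrm{Hom}([i,j],[i',j'])\ne0$ iff $i\le i'\le j\le j'$. A pair $(\mathcal G,\mathcal F)$ of subsets of balls is a torsion pair if $\mathcal G=\{X:\mathrm{Hom}(X,Y)=0\ \forall\,Y\in\mathcal F\}$ and $\mathcal F=\{Y:\mathrm{Hom}(X,Y)=0\ \forall\,X\in\mathcal G\}$; a torsion class is the set $\mathcal G$ of some torsion pair. Columns. For $1\le i\le n$, column $i$ is the ascending line of balls $[i,i],[i,i+1],\dots,[i,n]$, from lowest to highest. Young diagram with gaps of a torsion class. For each column $i$ that contains an element of $\mathcal G$, let $[i,j]$ be the lowest ball of column $i$ in $\mathcal G$, and put boxes on $[i,j]$ and on all balls $[i,j']$, $j'\ge j$, above it in the same column.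 If column $i$ has no element of $\mathcal G$, put no boxes in it. The resulting set of boxes is $Y(\mathcal G)$. Removing gaps. Sort the columns of $Y(\mathcal G)$ by number of boxes in weakly decreasing order from left to right and align them at the top with no gaps; this gives a Young diagram whose column lengths are the sorted numbers of boxes. A Young diagram is a weakly decreasing sequence $\lambda_1\ge\lambda_2\ge\cdots\ge0$ of row lengths (the empty diagram allowed); it is a subdiagram of $(n,n-1,\dots,1)$ if $\lambda_i\le n+1-i$ for $1\le i\le n$ and $\lambda_i=0$ for $i>n$. *)

theory Defs
  imports Main
begin

(* The pair (i, j) stands for the ball [i, j]. *)
type_synonym ball = "nat \<times> nat"

definition balls :: "nat \<Rightarrow> ball set" where
  "balls n = {(i, j). 1 \<le> i \<and> i \<le> j \<and> j \<le> n}"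

fun hom_nonzero :: "ball \<Rightarrow> ball \<Rightarrow> bool" where
  "hom_nonzero (i, j) (i', j') \<longleftrightarrow> i \<le> i' \<and> i' \<le> j \<and> j \<le> j'"

definition torsion_pair :: "nat \<Rightarrow> ball set \<Rightarrow> ball set \<Rightarrow> bool" where
  "torsion_pair n G F \<longleftrightarrow>
     G \<subseteq> balls n \<and> F \<subseteq> balls n \<and>
     G = {X \<in> balls n. \<forall>Y\<in>F. \<not> hom_nonzero X Y} \<and>
     F = {Y \<in> balls n. \<forall>X\<in>G. \<not> hom_nonzero X Y}"

definition torsion_class :: "nat \<Rightarrow> ball set \<Rightarrow> bool" where
  "torsion_class n G \<longleftrightarrow> (\<exists>F. torsion_pair n G F)"

(* The second indices j of the balls [i, j] of a set B lying in column i,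
   which ascend with j. *)
definition column :: "ball set \<Rightarrow> nat \<Rightarrow> nat set" where
  "column B i = {j. (i, j) \<in> B}"

definition gap_diagram :: "nat \<Rightarrow> ball set \<Rightarrow> ball set" where
  "gap_diagram n G =
     {(i, j) \<in> balls n. column G i \<noteq> {} \<and> Min (column G i) \<le> j}"

definition sorted_column_lengths :: "nat \<Rightarrow> ball set \<Rightarrow> nat list" where
  "sorted_column_lengths n B = rev (sort (map (\<lambda>i. card (column B i)) [1..<Suc n]))"

(* A Young diagram is given by its row lengths. Rows are indexed from 0, so that
   lam k is the length of the (k+1)-st row from the top. *)
definition young_diagram :: "(nat \<Rightarrow> nat) \<Rightarrow> bool" where
  "young_diagram lam \<longleftrightarrow> antimono lam \<and> (\<exists>N. \<forall>k\<ge>N. lam k = 0)"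

definition subdiagram :: "(nat \<Rightarrow> nat) \<Rightarrow> (nat \<Rightarrow> nat) \<Rightarrow> bool" where
  "subdiagram lam mu \<longleftrightarrow> (\<forall>k. lam k \<le> mu k)"

(* (n, n-1, ..., 2, 1) *)
definition full_diagram :: "nat \<Rightarrow> nat \<Rightarrow> nat" where
  "full_diagram n k = (if k < n then n - k else 0)"

(* Columns of lengths cs ! 0, cs ! 1, ... aligned at the top: column c has a box in
   row k (counted from 0) iff k < cs ! c. *)
definition rows_of_columns :: "nat list \<Rightarrow> nat \<Rightarrow> nat" where
  "rows_of_columns cs k = card {c. c < length cs \<and> k < cs ! c}"

definition remove_gaps :: "nat \<Rightarrow> ball set \<Rightarrow> nat \<Rightarrow> nat" where
  "remove_gaps n B = rows_of_columns (sorted_column_lengths n B)"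

end

theory Submission
  imports Defs
begin

text \<open>
  Let \<open>U\<^sub>j\<close> be the set of columns whose lowest ball in \<open>G\<close> has second index at most \<open>j\<close>. A set \<open>G\<close> is a
  torsion class iff it consists of the balls \<open>[i, j]\<close> with \<open>{i..j} \<subseteq> U\<^sub>j\<close>, and row \<open>k\<close> (counted from 0)
  of the diagram of \<open>G\<close> without gaps has length \<open>card U\<^sub>n\<^sub>-\<^sub>k\<close>. Passing from \<open>U\<^sub>j\<^sub>-\<^sub>1\<close> to \<open>U\<^sub>j\<close> adds the
  largest elements of \<open>{1..j} - U\<^sub>j\<^sub>-\<^sub>1\<close>, so the chain of the \<open>U\<^sub>j\<close> can be recovered from the
  cardinalities, which can be any weakly increasing sequence with \<open>card U\<^sub>j \<le> j\<close>.
\<close>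

section \<open>Torsion classes and the sets \<open>U\<^sub>j\<close>, here
  \<open>reach G j\<close>\<close>

definition reach :: "ball set \<Rightarrow> nat \<Rightarrow> nat set" where
  "reach G j = {i. \<exists>b\<le>j. (i, b) \<in> G}"

lemma reach_mono: "b \<le> j \<Longrightarrow> reach G b \<subseteq> reach G j"
  unfolding reach_def by (blast intro: le_trans)

lemma reach_subset: "G \<subseteq> balls n \<Longrightarrow> reach G j \<subseteq> {1..j}"
  unfolding reach_def balls_def by fastforce

lemma torsion_class_subset_balls: "torsion_class n G \<Longrightarrow> G \<subseteq> balls n"
  unfolding torsion_class_def torsion_pair_def by blast

text \<open>A nonzero Hom from \<open>[i, j]\<close> ends in some \<open>[i', j']\<close> with
  \<open>i'\<close> in \<open>{i..j}\<close> and \<open>j \<le> j'\<close>. A ball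
  \<open>[i', b]\<close> of \<open>G\<close> with \<open>b \<le> j\<close> then has a nonzero Hom to
  it as well, so Hom into \<open>F\<close> vanishes once all columns in \<open>{i..j}\<close> are
  reached.\<close>

lemma torsion_class_iff:
  "torsion_class n G \<longleftrightarrow> G = {(i, j) \<in> balls n. {i..j} \<subseteq> reach G j}"
proof
  assume "torsion_class n G"
  then obtain F where GF: "torsion_pair n G F"
    unfolding torsion_class_def by blast
  have Gb: "G \<subseteq> balls n" and Fb: "F \<subseteq> balls n"
    and G: "X \<in> G \<longleftrightarrow> X \<in> balls n \<and> (\<forall>Y\<in>F. \<not> hom_nonzero X Y)" for X
    using GF unfolding torsion_pair_def by blast+
  have "{i..j} \<subseteq> reach G j" if ij: "(i, j) \<in> G" for i j
  proof
    fix k assume k: "k \<in> {i..j}"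
    \<comment> \<open>\<open>[k, j]\<close> is a quotient of \<open>[i, j]\<close>: whatever
      receives a nonzero Hom from it also receives one from \<open>[i, j]\<close>.\<close>
    have "(k, j) \<in> balls n"
      using ij Gb k unfolding balls_def by auto
    moreover have "\<not> hom_nonzero (k, j) Y" if "Y \<in> F" for Y
    proof -
      have "\<not> hom_nonzero (i, j) Y"
        using ij that G by blast
      then show ?thesis
        using k by (cases Y) auto
    qed
    ultimately show "k \<in> reach G j"
      unfolding reach_def using G by blast
  qed
  moreover have "(i, j) \<in> G" if ij: "(i, j) \<in> balls n" and sub: "{i..j} \<subseteq> reach G j" for i j
  proof -
    have "\<not> hom_nonzero (i, j) (i', j')" if Y: "(i', j') \<in> F" for i' j'
    proof
      assume hom: "hom_nonzero (i, j) (i', j')"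
      then have "i' \<in> reach G j"
        using sub by auto
      then obtain b where b: "b \<le> j" "(i', b) \<in> G"
        unfolding reach_def by blast
      then have "hom_nonzero (i', b) (i', j')"
        using Gb hom unfolding balls_def by auto
      then show False
        using b Y G by blast
    qed
    then show ?thesis
      using ij G by auto
  qed
  ultimately show "G = {(i, j) \<in> balls n. {i..j} \<subseteq> reach G j}"
    using Gb by auto
next
  assume G: "G = {(i, j) \<in> balls n. {i..j} \<subseteq> reach G j}"
  \<comment> \<open>The second condition on a torsion pair forces this choice of \<open>F\<close>;
    the first remains to be checked.\<close>
  define F where "F = {Y \<in> balls n. \<forall>X\<in>G. \<not> hom_nonzero X Y}"
  have Gb: "G \<subseteq> balls n"
    using equalityD1[OF G] by auto
  have "(i, j) \<in> G" if ij: "(i, j) \<in> balls n" and none: "\<forall>Y\<in>F. \<not> hom_nonzero (i, j) Y" for i j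
  proof -
    have "k \<in> reach G j" if k: "k \<in> {i..j}" for k
    proof -
      \<comment> \<open>\<open>[k, j]\<close> receives a nonzero Hom from \<open>[i, j]\<close>, so
        it is not in \<open>F\<close> and some ball of \<open>G\<close> has a nonzero Hom to it.
        That ball spans column \<open>k\<close> and has second index at most
        \<open>j\<close>.\<close>
      have "(k, j) \<in> balls n" "hom_nonzero (i, j) (k, j)"
        using ij k unfolding balls_def by auto
      then obtain X where "X \<in> G" "hom_nonzero X (k, j)"
        using none unfolding F_def by blast
      then obtain a b where ab: "(a, b) \<in> G" "a \<le> k" "k \<le> b" "b \<le> j"
        by (cases X) auto
      then have "{a..b} \<subseteq> reach G b"
        using subsetD[OF equalityD1[OF G]] by auto
      then show ?thesis
        using ab reach_mono[of b j G] by auto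
    qed
    then show ?thesis
      using ij by (subst G) auto
  qed
  then have "G = {X \<in> balls n. \<forall>Y\<in>F. \<not> hom_nonzero X Y}"
    using Gb unfolding F_def by auto
  then show "torsion_class n G"
    unfolding torsion_class_def torsion_pair_def using Gb F_def by blast
qed

section \<open>Row lengths after removing the gaps\<close>

lemma column_gap_diagram_gt_iff:
  assumes G: "G \<subseteq> balls n"
  shows "k < card (column (gap_diagram n G) i) \<longleftrightarrow> i \<in> reach G (n - k)"
proof (cases "column G i = {}")
  case True
  then have "column (gap_diagram n G) i = {}"
    unfolding gap_diagram_def column_def by auto
  then show ?thesis
    using True by (auto simp: reach_def column_def)
next
  case False
  define m where "m = Min (column G i)"
  have "column G i \<subseteq> {..n}"
    using G unfolding column_def balls_def by auto
  then have fin: "finite (column G i)"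
    using finite_subset by blast
  have m: "(i, m) \<in> G"
    using Min_in[OF fin False] unfolding m_def column_def by auto
  then have mb: "1 \<le> i" "i \<le> m" "m \<le> n"
    using G unfolding balls_def by auto
  \<comment> \<open>The column has \<open>n - m + 1\<close> boxes. For \<open>k \<ge> n\<close> the
    truncated \<open>n - k\<close> is 0, and \<open>m \<ge> 1\<close> makes both sides
    false.\<close>
  have "column (gap_diagram n G) i = {m..n}"
    using False mb unfolding gap_diagram_def m_def[symmetric]
      column_def[of "{(i, j) \<in> balls n. P i j}" for P]
    by (auto simp: m_def[symmetric] balls_def)
  moreover have "i \<in> reach G (n - k) \<longleftrightarrow> m \<le> n - k"
  proof
    assume "i \<in> reach G (n - k)"
    then obtain b where "b \<le> n - k" "b \<in> column G i"
      unfolding reach_def column_def by auto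
    then show "m \<le> n - k"
      using Min_le[OF fin] unfolding m_def by fastforce
  qed (use m in \<open>auto simp: reach_def\<close>)
  ultimately show ?thesis
    using mb by auto
qed

text \<open>A row length counts the columns longer than \<open>k\<close>, a number that sorting and
  reversing do not change.\<close>

lemma remove_gaps_eq_card_reach:
  assumes G: "G \<subseteq> balls n"
  shows "remove_gaps n (gap_diagram n G) k = card (reach G (n - k))"
proof -
  let ?f = "\<lambda>i. card (column (gap_diagram n G) i)"
  let ?xs = "map ?f [1..<Suc n]"
  have "remove_gaps n (gap_diagram n G) k = length (filter (\<lambda>x. k < x) (rev (sort ?xs)))"
    unfolding remove_gaps_def rows_of_columns_def sorted_column_lengths_def
    by (simp only: length_filter_conv_card)
  also have "\<dots> = length (filter (\<lambda>x. k < x) ?xs)"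
    by (simp only: rev_filter[symmetric] length_rev filter_sort length_sort)
  also have "\<dots> = card {i \<in> {1..n}. k < ?f i}"
    by (simp only: filter_map length_map o_def distinct_card[symmetric] distinct_filter distinct_upt)
      (auto intro!: arg_cong[where f = card])
  also have "{i \<in> {1..n}. k < ?f i} = reach G (n - k)"
    using reach_subset[OF G, of "n - k"] by (force simp: column_gap_diagram_gt_iff[OF G])
  finally show ?thesis .
qed

section \<open>Adjoining the largest elements missing from a set\<close>

definition top_extension :: "nat \<Rightarrow> nat set \<Rightarrow> nat set \<Rightarrow> bool" where
  "top_extension j U A \<longleftrightarrow> U \<subseteq> A \<and> A \<subseteq> {1..j} \<and> (\<forall>i\<in>A - U. {i..j} \<subseteq> A)"

text \<open>Elements of \<open>A - B\<close> and of \<open>B - A\<close> lie outside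
  \<open>U\<close>, so each brings in everything above it up to \<open>j\<close>; the larger of two
  such elements would lie in both sets.\<close>

lemma top_extension_linear:
  assumes A: "top_extension j U A" and B: "top_extension j U B"
  shows "A \<subseteq> B \<or> B \<subseteq> A"
proof (rule ccontr)
  assume "\<not> ?thesis"
  then obtain a b where "a \<in> A" "a \<notin> B" "b \<in> B" "b \<notin> A"
    by blast
  moreover from this have "{a..j} \<subseteq> A" "{b..j} \<subseteq> B" "a \<le> j" "b \<le> j"
    using A B unfolding top_extension_def by auto
  ultimately show False
    by (meson atLeastAtMost_iff nle_le subsetD)
qed

lemma top_extension_unique:
  assumes "top_extension j U A" "top_extension j U B" "card A = card B"
  shows "A = B"
proof -
  have "finite A" "finite B"
    using assms finite_subset[OF _ finite_atLeastAtMost] unfolding top_extension_def by blast+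
  then show ?thesis
    using top_extension_linear[OF assms(1,2)] assms(3) card_subset_eq by metis
qed

text \<open>Starting from \<open>U\<close>, adjoin repeatedly the largest element of
  \<open>{1..j}\<close> still missing.\<close>

lemma top_extension_exists:
  assumes U: "U \<subseteq> {1..j}" and "card U \<le> N" "N \<le> j"
  shows "\<exists>A. top_extension j U A \<and> card A = N"
  using assms(2,3)
proof (induction N rule: dec_induct)
  case base
  then show ?case
    using U unfolding top_extension_def by blast
next
  case (step N)
  then obtain A where A: "top_extension j U A" "card A = N"
    by auto
  have Aj: "A \<subseteq> {1..j}"
    using A unfolding top_extension_def by blast
  then have fin: "finite A"
    using finite_subset by blast
  have "{1..j} - A \<noteq> {}"
    using step.prems A(2) card_mono[OF fin, of "{1..j}"] by auto
  define m where "m = Max ({1..j} - A)"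
  have m: "m \<in> {1..j} - A"
    unfolding m_def by (rule Max_in) (use \<open>{1..j} - A \<noteq> {}\<close> in auto)
  have above: "{m..j} \<subseteq> insert m A"
  proof
    fix x assume x: "x \<in> {m..j}"
    show "x \<in> insert m A"
    proof (rule ccontr)
      assume "x \<notin> insert m A"
      then have "x \<in> {1..j} - A" "x \<noteq> m"
        using x m by auto
      moreover from this have "x \<le> m"
        unfolding m_def by (intro Max_ge) auto
      ultimately show False
        using x by simp
    qed
  qed
  have "{i..j} \<subseteq> insert m A" if "i \<in> insert m A - U" for i
    using that A(1) above unfolding top_extension_def by (cases "i = m") blast+
  then have "top_extension j U (insert m A)"
    using A(1) m unfolding top_extension_def by auto
  moreover have "card (insert m A) = Suc N"
    using A(2) m fin by simp
  ultimately show ?case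
    by blast
qed

section \<open>Torsion classes as chains of top extensions\<close>

lemma top_extension_reach_Suc:
  assumes "torsion_class n G"
  shows "top_extension (Suc j) (reach G j) (reach G (Suc j))"
proof -
  have G: "G = {(i, j) \<in> balls n. {i..j} \<subseteq> reach G j}"
    using assms torsion_class_iff by simp
  have "{i..Suc j} \<subseteq> reach G (Suc j)" if "i \<in> reach G (Suc j) - reach G j" for i
  proof -
    \<comment> \<open>A column first reached at \<open>Suc j\<close> contains this ball, and all
      columns that the ball spans are reached by then.\<close>
    from that have "(i, Suc j) \<in> G"
      unfolding reach_def by (auto simp: le_Suc_eq)
    then show ?thesis
      using subsetD[OF equalityD1[OF G]] by auto
  qed
  then show ?thesis
    unfolding top_extension_def
    using reach_mono[of j "Suc j" G] reach_subset[OF torsion_class_subset_balls[OF assms]] by simp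
qed

text \<open>Injectivity: starting from the empty set, each \<open>reach G j\<close> is recovered
  from the previous one and its own size, and these sets determine \<open>G\<close>.\<close>

lemma torsion_class_eqI:
  assumes G: "torsion_class n G" and H: "torsion_class n H"
    and card: "\<And>j. j \<le> n \<Longrightarrow> card (reach G j) = card (reach H j)"
  shows "G = H"
proof -
  have "reach G j = reach H j" if "j \<le> n" for j
    using that
  proof (induction j)
    case 0
    show ?case
      using reach_subset[OF torsion_class_subset_balls[OF G], of 0]
        reach_subset[OF torsion_class_subset_balls[OF H], of 0] by simp
  next
    case (Suc j)
    then show ?case
      using top_extension_unique[of "Suc j" "reach G j"] card[of "Suc j"]
        top_extension_reach_Suc[OF G, of j] top_extension_reach_Suc[OF H, of j] by simp
  qed
  then have "{(i, j) \<in> balls n. {i..j} \<subseteq> reach G j} = {(i, j) \<in> balls n. {i..j} \<subseteq> reach H j}"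
    unfolding balls_def by auto
  then show ?thesis
    using G H torsion_class_iff by simp
qed

text \<open>\<open>G\<close> is built from the fixed-point condition with \<open>U\<close> in place
  of \<open>reach G\<close>, so it suffices that \<open>reach G\<close> returns \<open>U\<close>.
  This is claimed only up to \<open>n\<close>, where the balls stop.\<close>

lemma torsion_class_of_chain:
  fixes n :: nat
  assumes U0: "U 0 = {}" and U: "\<And>j. top_extension (Suc j) (U j) (U (Suc j))"
  defines "G \<equiv> {(i, j) \<in> balls n. {i..j} \<subseteq> U j}"
  shows "torsion_class n G" and "\<And>j. j \<le> n \<Longrightarrow> reach G j = U j"
proof -
  have mono: "U a \<subseteq> U b" if "a \<le> b" for a b
    using U that lift_Suc_mono_le[of U] unfolding top_extension_def by blast
  show reach: "reach G j = U j" if "j \<le> n" for j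
  proof
    show "reach G j \<subseteq> U j"
    proof
      fix i assume "i \<in> reach G j"
      then obtain b where "b \<le> j" "(i, b) \<in> G"
        unfolding reach_def by blast
      then have "i \<in> U b"
        unfolding G_def balls_def by auto
      then show "i \<in> U j"
        using mono \<open>b \<le> j\<close> by blast
    qed
    show "U j \<subseteq> reach G j"
      using that
    proof (induction j)
      case (Suc j)
      show ?case
      proof
        fix i assume i: "i \<in> U (Suc j)"
        show "i \<in> reach G (Suc j)"
        proof (cases "i \<in> U j")
          case True
          then show ?thesis
            using Suc reach_mono[of j "Suc j" G] by auto
        next
          case False
          \<comment> \<open>A new element comes with everything above it, so
            \<open>[i, Suc j]\<close> itself is in \<open>G\<close>.\<close>
          then have "{i..Suc j} \<subseteq> U (Suc j)" "i \<in> {1..Suc j}"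
            using U[of j] i unfolding top_extension_def by blast+
          then show ?thesis
            using Suc.prems unfolding reach_def G_def balls_def by auto
        qed
      qed
    qed (simp add: U0)
  qed
  have "{(i, j) \<in> balls n. {i..j} \<subseteq> reach G j} = G"
    using reach by (auto simp: G_def balls_def)
  then show "torsion_class n G"
    unfolding torsion_class_iff by simp
qed

text \<open>Dependent choice: \<open>N (Suc j)\<close> lies between \<open>card (U j)\<close> and
  \<open>Suc j\<close>, as each extension requires.\<close>

lemma top_extension_chain_exists:
  assumes "mono N" and N: "\<And>j. N j \<le> j"
  shows "\<exists>U. U 0 = {} \<and> (\<forall>j. top_extension (Suc j) (U j) (U (Suc j)) \<and> card (U j) = N j)"
proof -
  have "\<exists>U. \<forall>j. (U j \<subseteq> {1..j} \<and> card (U j) = N j) \<and> top_extension (Suc j) (U j) (U (Suc j))"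
  proof (rule dependent_nat_choice)
    show "\<exists>A. A \<subseteq> {1..0} \<and> card A = N 0"
      using N[of 0] by (intro exI[of _ "{}"]) simp
  next
    fix A j assume A: "A \<subseteq> {1..j} \<and> card A = N j"
    then have "A \<subseteq> {1..Suc j}" "card A \<le> N (Suc j)"
      using monoD[OF \<open>mono N\<close>, of j "Suc j"] by auto
    then obtain B where "top_extension (Suc j) A B" "card B = N (Suc j)"
      using top_extension_exists N by blast
    then show "\<exists>B. (B \<subseteq> {1..Suc j} \<and> card B = N (Suc j)) \<and> top_extension (Suc j) A B"
      unfolding top_extension_def by blast
  qed
  then obtain U where
    "\<forall>j. (U j \<subseteq> {1..j} \<and> card (U j) = N j) \<and> top_extension (Suc j) (U j) (U (Suc j))"
    by blast
  moreover from this have "U 0 \<subseteq> {1..0}"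
    by blast
  ultimately show ?thesis
    by auto
qed

section \<open>Bijection with the subdiagrams of the staircase\<close>

lemma full_diagram_eq: "full_diagram n k = n - k"
  by (simp add: full_diagram_def)

theorem mainTheorem7:
  fixes n :: nat
  assumes "n \<ge> 1"
  shows "bij_betw (\<lambda>G. remove_gaps n (gap_diagram n G))
           {G. torsion_class n G}
           {lam. young_diagram lam \<and> subdiagram lam (full_diagram n)}"
proof -
  let ?f = "\<lambda>G. remove_gaps n (gap_diagram n G)"
  note sub = torsion_class_subset_balls
  have f: "?f G k = card (reach G (n - k))" if "torsion_class n G" for G k
    using remove_gaps_eq_card_reach[OF sub[OF that]] .
  have bound: "card (reach G j) \<le> j" if "torsion_class n G" for G j
    using card_mono[OF _ reach_subset[OF sub[OF that]], of j] by simp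
  have fin: "finite (reach G j)" if "torsion_class n G" for G j
    using finite_subset[OF reach_subset[OF sub[OF that]]] by blast
  show ?thesis
  proof (rule bij_betw_imageI)
    show "inj_on ?f {G. torsion_class n G}"
    proof (rule inj_onI)
      fix G H assume GH: "G \<in> {G. torsion_class n G}" "H \<in> {G. torsion_class n G}"
        and eq: "?f G = ?f H"
      have "card (reach G j) = card (reach H j)" if "j \<le> n" for j
        using fun_cong[OF eq, of "n - j"] f[of G "n - j"] f[of H "n - j"] GH that by simp
      then show "G = H"
        using GH torsion_class_eqI by blast
    qed
    show "?f ` {G. torsion_class n G} = {lam. young_diagram lam \<and> subdiagram lam (full_diagram n)}"
    proof (intro subset_antisym subsetI)
      fix lam assume "lam \<in> ?f ` {G. torsion_class n G}"
      then obtain G where G: "torsion_class n G" and lam: "lam = ?f G"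
        by blast
      have "antimono lam"
        unfolding lam by (intro antimonoI) (simp add: f[OF G] card_mono[OF fin[OF G]] reach_mono)
      \<comment> \<open>This bound is the staircase itself and also empties all rows from
        \<open>n\<close> on.\<close>
      moreover have "lam k \<le> n - k" for k
        unfolding lam using f[OF G] bound[OF G] by simp
      ultimately show "lam \<in> {lam. young_diagram lam \<and> subdiagram lam (full_diagram n)}"
        unfolding young_diagram_def subdiagram_def full_diagram_eq
        by (auto intro!: exI[of _ n]) (metis diff_is_0_eq le_zero_eq)
    next
      fix lam assume "lam \<in> {lam. young_diagram lam \<and> subdiagram lam (full_diagram n)}"
      then have anti: "antimono lam" and le: "lam k \<le> n - k" for k
        unfolding young_diagram_def subdiagram_def full_diagram_eq by blast+
      \<comment> \<open>The sizes of the chain are the rows read from the bottom. Beyond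
        \<open>n\<close> the truncated \<open>n - j\<close> is 0, so the sequence stays at
        \<open>lam 0\<close>.\<close>
      have "mono (\<lambda>j. lam (n - j))"
        by (intro monoI antimonoD[OF anti]) simp
      moreover have "lam (n - j) \<le> j" for j
        using le[of "n - j"] by simp
      ultimately obtain U where U: "U 0 = {}" "\<And>j. top_extension (Suc j) (U j) (U (Suc j))"
        and card: "\<And>j. card (U j) = lam (n - j)"
        using top_extension_chain_exists[of "\<lambda>j. lam (n - j)"] by blast
      define G where "G = {(i, j) \<in> balls n. {i..j} \<subseteq> U j}"
      have G: "torsion_class n G" "\<And>j. j \<le> n \<Longrightarrow> reach G j = U j"
        unfolding G_def using torsion_class_of_chain[OF U] by blast+
      have "?f G k = lam k" for k
      proof -
        have "?f G k = lam (n - (n - k))"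
          using f[OF G(1)] G(2)[of "n - k"] card by simp
        \<comment> \<open>For \<open>k > n\<close> the index on the left is \<open>n\<close> rather
          than \<open>k\<close>, but both rows are empty.\<close>
        also have "\<dots> = lam k"
          using le[of k] le[of n] by (cases "k \<le> n") auto
        finally show ?thesis .
      qed
      then show "lam \<in> ?f ` {G. torsion_class n G}"
        using G(1) by (intro image_eqI[of _ _ G]) auto
    qed
  qed
qed

end
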